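(* Let $c:X\times Y\to\mathbb{R}_{\ge 0}$ be continuous and bounded and let $F:\mathbb{R}^N\to\mathbb{R}$ be lower semicontinuous. Then the primal problem has a minimizer: there exist $\lambda\in\Lambda$ and $\gamma\in\Pi(\mu,\nu_\lambda)$ such that $$\int_{X\times Y} c\,d\gamma+F(\lambda)\le \int_{X\times Y} c\,d\tilde\gamma+F(\tilde\lambda)$$ for every $\tilde\lambda\in\Lambda$ and every $\tilde\gamma\in\Pi(\mu,\nu_{\tilde\lambda})$.
   Context: Fix positive integers $N,n$, a set $Y=\{y_j\}_{j=1}^N\subset\mathbb{R}^n$ of $N$ points, a compact set $X\subset\mathbb{R}^n$, and a Borel probability measure $\mu$ on $X$ with $\operatorname{spt}\mu=X$. Write $\Lambda=\{\lambda\in\mathbb{R}^N: \sum_{j=1}^N\lambda^j=1,\ \lambda^j\ge 0\}$ and, for $\lambda\in\Lambda$, $\nu_\lambda=\sum_{j=1}^N\lambda^j\delta_{y_j}$. $\Pi(\mu,\nu)$ is the set of probability measures on $X\times Y$ with left and right marginals $\mu$ and $\nu$. *)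

theory Defs
  imports "HOL-Probability.Probability"
begin

definition borel_prob_measures :: "'a::topological_space set \<Rightarrow> 'a measure set" where
  "borel_prob_measures S = {M. prob_space M \<and> sets M = sets (restrict_space borel S)}"

text \<open>
  The support of a Borel measure on a subspace. The relatively open subsets of the subspace are
  the sets \<open>U \<inter> space M\<close> with \<open>U\<close> open in the ambient space.
\<close>
definition spt :: "'a::topological_space measure \<Rightarrow> 'a set" where
  "spt M = {x \<in> space M. \<forall>U. open U \<and> x \<in> U \<longrightarrow> emeasure M (U \<inter> space M) > 0}"

definition weight_simplex :: "(real ^ 'N) set" where
  "weight_simplex = {l. (\<Sum>j\<in>UNIV. l $ j) = 1 \<and> (\<forall>j. 0 \<le> l $ j)}"

text \<open>
  The measure \<open>\<Sum>\<^sub>j l\<^sup>j \<delta>\<^bsub>y j\<^esub>\<close> on the Borel sets of \<open>range y\<close>; the Dirac mass is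
  \<^const>\<open>return\<close>. Only nonnegative weights are meaningful, since \<^const>\<open>ennreal\<close> truncates.
\<close>
definition discrete_measure :: "('N \<Rightarrow> 'a::topological_space) \<Rightarrow> real ^ 'N \<Rightarrow> 'a measure" where
  "discrete_measure y l =
     measure_of (range y) (sets (restrict_space borel (range y)))
       (\<lambda>A. \<Sum>j\<in>UNIV. ennreal (l $ j) * emeasure (return (restrict_space borel (range y)) (y j)) A)"

text \<open>
  Couplings of a measure on \<open>X\<close> and a measure on \<open>Y\<close>, as Borel probability measures on the
  subspace \<open>X \<times> Y\<close> of the product space.
\<close>
definition transport_plans ::
  "'a::topological_space measure \<Rightarrow> 'b::topological_space measure \<Rightarrow> ('a \<times> 'b) measure set" where
  "transport_plans M N =
     {G \<in> borel_prob_measures (space M \<times> space N). distr G M fst = M \<and> distr G N snd = N}"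

definition lower_semicontinuous :: "('a::topological_space \<Rightarrow> real) \<Rightarrow> bool" where
  "lower_semicontinuous F \<longleftrightarrow> (\<forall>x a. a < F x \<longrightarrow> (\<forall>\<^sub>F z in nhds x. a < F z))"

lemma space_discrete_measure [simp]: "space (discrete_measure y l) = range y"
  unfolding discrete_measure_def
  by (rule space_measure_of) (use sets.space_closed[of "restrict_space borel (range y)"] in
      \<open>simp add: space_restrict_space\<close>)

lemma sets_discrete_measure [simp]:
  "sets (discrete_measure y l) = sets (restrict_space borel (range y))"
  unfolding discrete_measure_def
  using sets.sets_measure_of_eq[of "restrict_space borel (range y)"]
  by (simp add: space_restrict_space)

lemma emeasure_discrete_measure:
  fixes y :: "'N::finite \<Rightarrow> 'b::topological_space"
  assumes A: "A \<in> sets (restrict_space borel (range y))"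
  shows "emeasure (discrete_measure y l) A = (\<Sum>j\<in>UNIV. ennreal (l $ j) * indicator A (y j))"
proof -
  let ?B = "restrict_space borel (range y)"
  let ?m = "\<lambda>A. \<Sum>j\<in>UNIV. ennreal (l $ j) * emeasure (return ?B (y j)) A"
  have "emeasure (discrete_measure y l) A = ?m A"
  proof (rule emeasure_measure_of[OF discrete_measure_def])
    show "sets ?B \<subseteq> Pow (range y)"
      using sets.space_closed[of ?B] by (simp add: space_restrict_space)
    show "A \<in> sets (discrete_measure y l)" using A by simp
    show "positive (sets (discrete_measure y l)) ?m" by (simp add: positive_def)
    show "countably_additive (sets (discrete_measure y l)) ?m"
    proof (rule countably_additiveI)
      fix B :: "nat \<Rightarrow> 'b set"
      assume B: "range B \<subseteq> sets (discrete_measure y l)" "disjoint_family B"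
      have eq: "(\<Sum>i. emeasure (return ?B (y j)) (B i)) = emeasure (return ?B (y j)) (\<Union>i. B i)" for j
        using B by (intro suminf_emeasure) simp_all
      have "(\<Sum>i. ?m (B i)) = (\<Sum>j\<in>UNIV. \<Sum>i. ennreal (l $ j) * emeasure (return ?B (y j)) (B i))"
        by (rule suminf_sum) simp
      also have "\<dots> = ?m (\<Union>i. B i)"
        by (simp only: ennreal_suminf_cmult eq)
      finally show "(\<Sum>i. ?m (B i)) = ?m (\<Union>i. B i)" .
    qed
  qed
  then show ?thesis using A by simp
qed

lemma discrete_measure_in_borel_prob_measures:
  assumes "l \<in> weight_simplex"
  shows "discrete_measure y l \<in> borel_prob_measures (range y)"
proof -
  have "range y \<in> sets (restrict_space borel (range y))"
    using sets.top[of "restrict_space borel (range y)"] by (simp add: space_restrict_space)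
  then have "emeasure (discrete_measure y l) (range y) = 1"
    using assms by (simp add: emeasure_discrete_measure weight_simplex_def sum_ennreal)
  then show ?thesis
    by (auto simp: borel_prob_measures_def intro!: prob_spaceI)
qed

end

theory Submission
  imports Defs
begin

text \<open>
  The existence proof is the direct method of the calculus of variations. Because \<open>Y\<close> is finite,
  weak compactness of the set of plans reduces to weak compactness of densities.

  Let \<open>P\<close> (the \<open>reference\<close> measure below) be the product of \<open>\<mu>\<close> with the counting measure on \<open>Y\<close>.
  A plan \<open>\<gamma>\<close> with left marginal \<open>\<mu>\<close> satisfies \<open>\<gamma> \<le> P\<close>: on the slice over \<open>y j\<close> its mass is at most that of the whole strip over the same
  part of \<open>X\<close>, which is given by \<open>\<mu>\<close>. By Radon-Nikodym \<open>\<gamma>\<close> therefore has a density with values in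
  \<open>[0,1]\<close> with respect to \<open>P\<close> (\<open>transport_plan_density\<close>). In terms of the density, the cost and both marginal
  conditions are linear: each prescribes, or is, the integral of the density against a bounded function
  (\<open>density_transport_plan_iff\<close>).

  Functions with values in \<open>[0,1]\<close> on a finite measure space are weakly sequentially compact in the
  following sense (\<open>unit_interval_functions_weakly_compact\<close>). Midpoints of members of the tails of a sequence
  are iterated, and an element of nearly minimal \<open>L\<^sup>2\<close> norm is chosen in each tail. The parallelogram
  identity makes these elements \<open>L\<^sup>2\<close>-Cauchy, so that they converge almost everywhere along a sufficiently
  fast choice. Averaging within a tail cannot destroy the convergence of a linear functional along the
  original sequence, and dominated convergence carries its limit over to the limit function.

  Now take a minimising sequence \<open>(\<lambda>\<^sub>k, \<gamma>\<^sub>k)\<close> and pass to a subsequence along which the weights, which lie in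
  the compact simplex, and the bounded costs converge, to \<open>\<lambda>\<close> and \<open>C\<close> say. The weak limit of the
  densities is the density of a plan for \<open>\<lambda>\<close> of cost exactly \<open>C\<close>. Only the \<open>F\<close>-term is not linear, and
  lower semicontinuity gives the inequality in the right direction there. The order of these choices matters:
  the densities are averaged only after the weights have converged, so \<open>F\<close> is never evaluated at an
  averaged weight, where lower semicontinuity along the original sequence would say nothing.
\<close>

section \<open>Weak compactness of functions with values in the unit interval\<close>

text \<open>
  The dyadic convex hull of the tail from \<open>n\<close> on. Midpoints alone suffice for the parallelogram identity,
  and they keep every statement about the hull a two-case induction.
\<close>
inductive_set midpoint_tail :: "(nat \<Rightarrow> 'a \<Rightarrow> real) \<Rightarrow> nat \<Rightarrow> ('a \<Rightarrow> real) set"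
  for f :: "nat \<Rightarrow> 'a \<Rightarrow> real" and n :: nat where
  member: "n \<le> k \<Longrightarrow> f k \<in> midpoint_tail f n"
| midpoint: "g \<in> midpoint_tail f n \<Longrightarrow> h \<in> midpoint_tail f n \<Longrightarrow>
    (\<lambda>x. (g x + h x) / 2) \<in> midpoint_tail f n"

lemma midpoint_tail_antimono:
  assumes "m \<le> n" shows "midpoint_tail f n \<subseteq> midpoint_tail f m"
proof
  fix g assume "g \<in> midpoint_tail f n"
  then show "g \<in> midpoint_tail f m"
    by induction (use assms in \<open>auto intro: midpoint_tail.intros\<close>)
qed

lemma midpoint_tail_measurable:
  assumes "g \<in> midpoint_tail f n" and "\<And>k. f k \<in> borel_measurable M"
  shows "g \<in> borel_measurable M"
  using assms(1) by induction (use assms(2) in auto)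

lemma midpoint_tail_bounds:
  assumes "g \<in> midpoint_tail f n" and "\<And>k x. f k x \<in> {0..1}"
  shows "g x \<in> {0..1}"
  using assms(1)
proof induction
  case (member k)
  then show ?case using assms(2) by blast
qed auto

lemma integrable_mult_unit_interval:
  fixes g h :: "'a \<Rightarrow> real"
  assumes "integrable M h" "g \<in> borel_measurable M" "\<And>x. g x \<in> {0..1}"
  shows "integrable M (\<lambda>x. h x * g x)"
proof (rule Bochner_Integration.integrable_bound[OF assms(1)])
  show "(\<lambda>x. h x * g x) \<in> borel_measurable M"
    using assms by measurable
  show "AE x in M. norm (h x * g x) \<le> norm (h x)"
    using assms(3) by (auto simp: abs_mult mult_left_le)
qed

text \<open>
  Closed intervals are convex, so a bound on a linear functional along the tail survives averaging. This is how
  limits of functionals pass from the original sequence to the averaged one.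
\<close>
lemma midpoint_tail_functional:
  assumes g: "g \<in> midpoint_tail f n"
    and meas: "\<And>k. f k \<in> borel_measurable M" and bounds: "\<And>k x. f k x \<in> {0..1}"
    and h: "integrable M h"
    and close: "\<And>k. n \<le> k \<Longrightarrow> \<bar>(\<integral>x. h x * f k x \<partial>M) - L\<bar> \<le> e"
  shows "\<bar>(\<integral>x. h x * g x \<partial>M) - L\<bar> \<le> e"
  using g
proof induction
  case (member k)
  then show ?case by (rule close)
next
  case (midpoint u v)
  have int: "integrable M (\<lambda>x. h x * w x)" if "w \<in> midpoint_tail f n" for w
    using that by (intro integrable_mult_unit_interval h)
      (auto intro!: midpoint_tail_measurable[where f=f] meas dest: midpoint_tail_bounds[where f=f, OF _ bounds])
  have "(\<integral>x. h x * ((u x + v x) / 2) \<partial>M) = (\<integral>x. (h x * u x + h x * v x) / 2 \<partial>M)"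
    by (simp add: algebra_simps)
  also have "\<dots> = ((\<integral>x. h x * u x \<partial>M) + (\<integral>x. h x * v x \<partial>M)) / 2"
    using midpoint.hyps int by simp
  finally show ?case
    using midpoint.IH by (simp add: abs_le_iff field_simps)
qed

text \<open>
  The infima \<open>d n\<close> of the squared \<open>L\<^sup>2\<close> norm over the tails increase to a limit \<open>D\<close>. If \<open>u\<close> and \<open>v\<close> lie in a tail
  whose infimum is close to \<open>D\<close>, and both have squared norm close to \<open>D\<close>, then the squared norm of their
  midpoint is at least that infimum, and the parallelogram identity forces \<open>u - v\<close> to be small. The tails are taken late enough for the
  prescribed geometric rate.
\<close>
lemma (in finite_measure) midpoint_tail_L2_Cauchy:
  fixes f :: "nat \<Rightarrow> 'a \<Rightarrow> real"
  assumes meas: "\<And>k. f k \<in> borel_measurable M" and bounds: "\<And>k x. f k x \<in> {0..1}"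
  shows "\<exists>g. (\<forall>n. g n \<in> midpoint_tail f n) \<and>
             (\<forall>n. (\<integral>x. (g (Suc n) x - g n x)\<^sup>2 \<partial>M) \<le> (1/4)^n)"
proof -
  define Q where "Q u = (\<integral>x. (u x)\<^sup>2 \<partial>M)" for u :: "'a \<Rightarrow> real"
  define d where "d n = (INF u\<in>midpoint_tail f n. Q u)" for n
  \<comment> \<open>The parallelogram identity below loses a factor 8.\<close>
  define e where "e n = (1/4)^n / (8::real)" for n :: nat
  have e_pos: "e n > 0" and e_Suc: "e (Suc n) \<le> e n" for n
    by (auto simp: e_def)
  have ne: "midpoint_tail f n \<noteq> {}" for n
    using midpoint_tail.member[of n n f] by blast
  have int: "integrable M (\<lambda>x. (u x)\<^sup>2)" "integrable M (\<lambda>x. u x * v x)"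
    if "u \<in> midpoint_tail f n" "v \<in> midpoint_tail f m" for u v n m
  proof -
    have uv: "u \<in> borel_measurable M" "v \<in> borel_measurable M" "\<And>x. u x \<in> {0..1}" "\<And>x. v x \<in> {0..1}"
      using that midpoint_tail_measurable[where f=f, OF _ meas] midpoint_tail_bounds[where f=f, OF _ bounds] by blast+
    have "integrable M u"
      using uv by (intro integrable_const_bound[of _ 1]) auto
    then show "integrable M (\<lambda>x. u x * v x)" "integrable M (\<lambda>x. (u x)\<^sup>2)"
      using uv by (auto simp: power2_eq_square intro!: integrable_mult_unit_interval)
  qed
  have bdd: "bdd_below (Q ` midpoint_tail f n)" for n
    by (rule bdd_belowI[of _ 0]) (auto simp: Q_def)
  have d_le: "d n \<le> Q u" if "u \<in> midpoint_tail f n" for u n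
    unfolding d_def by (rule cINF_lower[OF bdd that])
  have Q_le: "Q u \<le> measure M (space M)" if "u \<in> midpoint_tail f n" for u n
  proof -
    have "Q u \<le> (\<integral>x. 1 \<partial>M)"
      unfolding Q_def using midpoint_tail_bounds[where f=f, OF that bounds]
      by (intro integral_mono int[OF that that]) (auto simp: power_le_one)
    then show ?thesis by simp
  qed
  have "incseq d"
    unfolding d_def
    by (intro incseq_SucI cINF_superset_mono ne bdd midpoint_tail_antimono) auto
  moreover have "d n \<le> measure M (space M)" for n
    using d_le Q_le midpoint_tail.member[of n n f] order_trans by blast
  ultimately obtain D where D: "d \<longlonglongrightarrow> D" and d_le_D: "\<And>n. d n \<le> D"
    using incseq_convergent[of d] by metis
  have "\<exists>K. \<forall>m\<ge>K. D - e n < d m" for n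
    using order_tendstoD(1)[OF D, of "D - e n"] e_pos[of n]
    by (auto simp: eventually_sequentially)
  then obtain K where K: "\<And>n m. K n \<le> m \<Longrightarrow> D - e n < d m"
    by metis
  \<comment> \<open>Summing makes the starting points monotone, so that the choices for \<open>n\<close> and \<open>Suc n\<close> share a tail.\<close>
  define N where "N n = (\<Sum>i\<le>n. K i) + n" for n
  have N_mono: "N n \<le> N (Suc n)" and n_le_N: "n \<le> N n" and K_le_N: "K n \<le> N n" for n
    by (auto simp: N_def intro: trans_le_add1 member_le_sum)
  have "\<exists>u \<in> midpoint_tail f (N n). Q u < D + e n" for n
  proof -
    have "d (N n) < D + e n"
      using d_le_D[of "N n"] e_pos[of n] by linarith
    then show ?thesis
      unfolding d_def using cINF_less_iff[OF ne bdd] by blast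
  qed
  then obtain g where g: "\<And>n. g n \<in> midpoint_tail f (N n)" "\<And>n. Q (g n) < D + e n"
    by metis
  have g': "g n \<in> midpoint_tail f n" for n
    using g(1) midpoint_tail_antimono[OF n_le_N] by blast
  have "(\<integral>x. (g (Suc n) x - g n x)\<^sup>2 \<partial>M) \<le> (1/4)^n" for n
  proof -
    let ?u = "g n" and ?v = "g (Suc n)"
    have v: "?v \<in> midpoint_tail f (N n)"
      using g(1) midpoint_tail_antimono[OF N_mono] by blast
    note ints = int[OF g(1) g(1)]
    have "D - e n < Q (\<lambda>x. (?u x + ?v x) / 2)"
      using K[OF K_le_N[of n]] d_le[OF midpoint_tail.midpoint[OF g(1)[of n] v]] by linarith
    moreover have "(\<integral>x. (?v x - ?u x)\<^sup>2 \<partial>M) =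
      (\<integral>x. 2 * (?u x)\<^sup>2 + 2 * (?v x)\<^sup>2 - 4 * ((?u x + ?v x) / 2)\<^sup>2 \<partial>M)"
      by (intro Bochner_Integration.integral_cong) (auto simp: power2_eq_square field_simps)
    moreover have "\<dots> = 2 * Q ?u + 2 * Q ?v - 4 * Q (\<lambda>x. (?u x + ?v x) / 2)"
      unfolding Q_def
      using ints int[OF midpoint_tail.midpoint[OF g(1)[of n] v] g(1)] by simp
    ultimately have "(\<integral>x. (?v x - ?u x)\<^sup>2 \<partial>M) \<le> 8 * e n"
      using g(2)[of n] g(2)[of "Suc n"] e_Suc[of n] by linarith
    then show ?thesis by (simp add: e_def)
  qed
  then show ?thesis using g' by blast
qed

text \<open>
  On a finite measure space the \<open>L\<^sup>2\<close> bounds give summable \<open>L\<^sup>1\<close> norms of the increments. Hence the sum of the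
  absolute increments has finite integral, is finite almost everywhere, and the telescoping series
  converges there.
\<close>
lemma (in finite_measure) AE_convergent_if_L2_increments_geometric:
  fixes g :: "nat \<Rightarrow> 'a \<Rightarrow> real"
  assumes meas: "\<And>n. g n \<in> borel_measurable M" and bounds: "\<And>n x. g n x \<in> {0..1}"
    and incr: "\<And>n. (\<integral>x. (g (Suc n) x - g n x)\<^sup>2 \<partial>M) \<le> (1/4)^n"
  shows "AE x in M. convergent (\<lambda>n. g n x)"
proof -
  define C where "C = (measure M (space M) + 1) / 2"
  let ?d = "\<lambda>n x. g (Suc n) x - g n x"
  have d_le: "\<bar>?d n x\<bar> \<le> 1" for n x
    using bounds[of n x] bounds[of "Suc n" x] by auto
  have int: "integrable M (\<lambda>x. \<bar>?d n x\<bar>)" "integrable M (\<lambda>x. (?d n x)\<^sup>2)" for n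
    using meas d_le by (auto intro!: integrable_const_bound[of _ 1] simp: abs_square_le_1)
  have L1: "(\<integral>x. \<bar>?d n x\<bar> \<partial>M) \<le> C * (1/2)^n" for n
  proof -
    \<comment> \<open>The weight \<open>2^n\<close> balances the constant term against the square, whose integral is at most \<open>(1/4)^n\<close>:
      both contribute of order \<open>(1/2)^n\<close>.\<close>
    have amgm: "\<bar>t\<bar> \<le> ((1/2)^n + 2^n * t\<^sup>2) / 2" for t :: real
    proof -
      have "0 \<le> (1/2)^n * (1 - 2^n * \<bar>t\<bar>)\<^sup>2" by simp
      also have "\<dots> = (1/2)^n * (1 - 2 * (2^n * \<bar>t\<bar>) + 2^n * 2^n * t\<^sup>2)"
        by (simp add: power2_eq_square algebra_simps)
      also have "\<dots> = (1/2)^n - 2 * \<bar>t\<bar> + 2^n * t\<^sup>2"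
        by (simp add: field_simps power_one_over)
      finally show ?thesis by simp
    qed
    have "(\<integral>x. \<bar>?d n x\<bar> \<partial>M) \<le> (\<integral>x. ((1/2)^n + 2^n * (?d n x)\<^sup>2) / 2 \<partial>M)"
      using int[of n] by (intro integral_mono amgm) (simp_all del: power_one_over)
    also have "\<dots> = ((1/2)^n * measure M (space M) + 2^n * (\<integral>x. (?d n x)\<^sup>2 \<partial>M)) / 2"
      using int by simp
    also have "\<dots> \<le> ((1/2)^n * measure M (space M) + 2^n * (1/4)^n) / 2"
      using incr by (intro divide_right_mono add_left_mono mult_left_mono) auto
    also have "(2::real)^n * (1/4)^n = (1/2)^n"
      by (simp flip: power_mult_distrib)
    finally show ?thesis by (simp add: C_def field_simps)
  qed
  have "(\<integral>\<^sup>+x. (\<Sum>n. ennreal \<bar>?d n x\<bar>) \<partial>M) = (\<Sum>n. \<integral>\<^sup>+x. ennreal \<bar>?d n x\<bar> \<partial>M)"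
    using meas by (intro nn_integral_suminf) auto
  also have "\<dots> = (\<Sum>n. ennreal (\<integral>x. \<bar>?d n x\<bar> \<partial>M))"
    using int by (subst nn_integral_eq_integral) auto
  also have "\<dots> \<le> (\<Sum>n. ennreal (C * (1/2)^n))"
    using L1 by (intro suminf_le ennreal_leI) auto
  also have "\<dots> < \<infinity>"
  proof -
    have "summable (\<lambda>n. C * (1/2)^n)" by (intro summable_mult summable_geometric) simp
    moreover have "0 \<le> C" by (simp add: C_def)
    ultimately show ?thesis
      by (subst suminf_ennreal2) auto
  qed
  finally have "(\<integral>\<^sup>+x. (\<Sum>n. ennreal \<bar>?d n x\<bar>) \<partial>M) \<noteq> \<infinity>"
    by simp
  then have "AE x in M. (\<Sum>n. ennreal \<bar>?d n x\<bar>) \<noteq> \<infinity>"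
    using meas by (intro nn_integral_noteq_infinite) auto
  then show ?thesis
  proof eventually_elim
    case (elim x)
    then have "summable (\<lambda>n. \<bar>?d n x\<bar>)"
      by (intro summable_suminf_not_top) auto
    then have "convergent (\<lambda>n. \<Sum>i<n. ?d i x)"
      by (intro summable_iff_convergent[THEN iffD1]) (rule summable_rabs_cancel)
    then have "convergent (\<lambda>n. g n x - g 0 x)"
      using sum_lessThan_telescope[of "\<lambda>n. g n x"] by simp
    then show ?case
      by (simp add: convergent_diff_const_right_iff)
  qed
qed

text \<open>
  A sequential Banach-Alaoglu property for the order interval \<open>[0,1]\<close> of \<open>L\<^sup>\<infinity>\<close>, phrased without a
  subsequence: the limit respects every functional that converges along the given sequence, so a caller
  thins out beforehand to make the functionals of interest converge.
\<close>
theorem (in finite_measure) unit_interval_functions_weakly_compact: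
  fixes f :: "nat \<Rightarrow> 'a \<Rightarrow> real"
  assumes meas: "\<And>k. f k \<in> borel_measurable M" and bounds: "\<And>k x. f k x \<in> {0..1}"
  obtains g where "g \<in> borel_measurable M" and "\<And>x. g x \<in> {0..1}"
    and "\<And>h L. integrable M h \<Longrightarrow> (\<lambda>k. \<integral>x. h x * f k x \<partial>M) \<longlonglongrightarrow> L \<Longrightarrow> (\<integral>x. h x * g x \<partial>M) = L"
proof -
  obtain u where u: "\<And>n. u n \<in> midpoint_tail f n"
      "\<And>n. (\<integral>x. (u (Suc n) x - u n x)\<^sup>2 \<partial>M) \<le> (1/4)^n"
    using midpoint_tail_L2_Cauchy[where f=f, OF meas bounds] by auto
  have u_meas: "u n \<in> borel_measurable M" and u_bounds: "u n x \<in> {0..1}" for n x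
    using midpoint_tail_measurable[where f=f, OF u(1) meas] midpoint_tail_bounds[where f=f, OF u(1) bounds] by auto
  \<comment> \<open>Truncation matters only on the null set where the limit does not exist and \<open>lim\<close> is arbitrary.\<close>
  define g where "g x = max 0 (min 1 (lim (\<lambda>n. u n x)))" for x
  have g_meas: "g \<in> borel_measurable M"
    unfolding g_def using u_meas by measurable
  have g_bounds: "g x \<in> {0..1}" for x
    by (simp add: g_def)
  have lim: "AE x in M. (\<lambda>n. u n x) \<longlonglongrightarrow> g x"
    using AE_convergent_if_L2_increments_geometric[where g=u, OF u_meas u_bounds u(2)]
  proof eventually_elim
    case (elim x)
    then have L: "(\<lambda>n. u n x) \<longlonglongrightarrow> lim (\<lambda>n. u n x)"
      by (simp add: convergent_LIMSEQ_iff)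
    then have "lim (\<lambda>n. u n x) \<in> {0..1}"
      by (rule closed_sequentially[OF closed_atLeastAtMost u_bounds])
    with L show ?case by (simp add: g_def)
  qed
  show ?thesis
  proof (rule that[OF g_meas g_bounds])
    fix h :: "'a \<Rightarrow> real" and L
    assume h: "integrable M h" and conv: "(\<lambda>k. \<integral>x. h x * f k x \<partial>M) \<longlonglongrightarrow> L"
    have "(\<lambda>n. \<integral>x. h x * u n x \<partial>M) \<longlonglongrightarrow> L"
    proof (rule LIMSEQ_I)
      fix r :: real assume "0 < r"
      then obtain n where n: "\<And>k. n \<le> k \<Longrightarrow> \<bar>(\<integral>x. h x * f k x \<partial>M) - L\<bar> \<le> r / 2"
        using LIMSEQ_D[OF conv, of "r / 2"] by (auto intro: less_imp_le)
      have "\<bar>(\<integral>x. h x * u m x \<partial>M) - L\<bar> \<le> r / 2" if "n \<le> m" for m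
        using u(1)[of m] midpoint_tail_antimono[OF that]
        by (intro midpoint_tail_functional[where f = f and n = n, OF _ meas bounds h n]) auto
      with \<open>0 < r\<close> show "\<exists>no. \<forall>m\<ge>no. norm ((\<integral>x. h x * u m x \<partial>M) - L) < r"
        by (intro exI[of _ n]) force
    qed
    moreover have "(\<lambda>n. \<integral>x. h x * u n x \<partial>M) \<longlonglongrightarrow> (\<integral>x. h x * g x \<partial>M)"
    proof (rule integral_dominated_convergence[where w = "\<lambda>x. norm (h x)"])
      show "AE x in M. (\<lambda>n. h x * u n x) \<longlonglongrightarrow> h x * g x"
        using lim by eventually_elim (intro tendsto_intros)
      show "AE x in M. norm (h x * u n x) \<le> norm (h x)" for n
        using u_bounds[of n] by (auto simp: abs_mult mult_left_le)
    qed (use h u_meas g_meas in \<open>auto intro!: borel_measurable_times\<close>)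
    ultimately show "(\<integral>x. h x * g x \<partial>M) = L"
      using LIMSEQ_unique by blast
  qed
qed

section \<open>Borel sets on subspaces and dominated measures\<close>

lemma borel_prob_measuresD:
  assumes "M \<in> borel_prob_measures S"
  shows "prob_space M" "sets M = sets (restrict_space borel S)" "space M = S"
  using assms sets_eq_imp_space_eq[of M "restrict_space borel S"]
  by (auto simp: borel_prob_measures_def space_restrict_space)

lemma sets_restrict_borel_finite:
  fixes S :: "'a::t1_space set"
  assumes "finite S"
  shows "sets (restrict_space borel S) = Pow S"
proof
  show "sets (restrict_space borel S) \<subseteq> Pow S"
    using sets.space_closed[of "restrict_space borel S"] by (simp add: space_restrict_space)
  show "Pow S \<subseteq> sets (restrict_space borel S)"
  proof
    fix A assume "A \<in> Pow S"
    moreover from this have "A \<in> sets borel"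
      using assms by (auto intro: borel_closed finite_imp_closed finite_subset)
    ultimately show "A \<in> sets (restrict_space borel S)"
      by (auto simp: sets_restrict_space)
  qed
qed

text \<open>
  Plans live on the Borel sets of the subspace \<open>X \<times> Y\<close>, whereas the product measure lives on the product
  of the two trace \<open>\<sigma>\<close>-algebras. Second countability identifies them, for arbitrary, possibly
  non-Borel, subsets.
\<close>
lemma sets_restrict_borel_Times:
  fixes S :: "'a::second_countable_topology set" and T :: "'b::second_countable_topology set"
  shows "sets (restrict_space borel S \<Otimes>\<^sub>M restrict_space borel T) = sets (restrict_space borel (S \<times> T))"
    (is "sets ?P = sets ?R")
proof
  have space_P: "space ?P = S \<times> T" and space_R: "space ?R = S \<times> T"
    by (simp_all add: space_pair_measure space_restrict_space)
  have "(\<lambda>p. (fst p, snd p)) \<in> ?P \<rightarrow>\<^sub>M borel \<Otimes>\<^sub>M borel"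
    by (intro measurable_Pair measurable_compose[OF measurable_fst] measurable_compose[OF measurable_snd]
        measurable_restrict_space1 measurable_ident_sets) auto
  then have P: "(\<lambda>p. p) \<in> ?P \<rightarrow>\<^sub>M borel"
    by (simp add: borel_prod)
  show "sets ?R \<subseteq> sets ?P"
  proof
    fix A assume "A \<in> sets ?R"
    then obtain B where "B \<in> sets borel" "A = (S \<times> T) \<inter> B"
      by (auto simp: sets_restrict_space)
    then show "A \<in> sets ?P"
      using measurable_sets[OF P, of B] by (simp add: space_P Int_commute)
  qed
  have "(fst :: 'a \<times> 'b \<Rightarrow> 'a) \<in> borel \<rightarrow>\<^sub>M borel" "(snd :: 'a \<times> 'b \<Rightarrow> 'b) \<in> borel \<rightarrow>\<^sub>M borel"
    by (intro borel_measurable_continuous_onI continuous_intros)+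
  then have "(\<lambda>p. (fst p, snd p)) \<in> ?R \<rightarrow>\<^sub>M ?P"
    by (intro measurable_Pair measurable_restrict_space2 measurable_restrict_space1)
      (auto simp: space_restrict_space)
  then have R: "(\<lambda>p. p) \<in> ?R \<rightarrow>\<^sub>M ?P"
    by simp
  show "sets ?P \<subseteq> sets ?R"
  proof
    fix A assume A: "A \<in> sets ?P"
    then show "A \<in> sets ?R"
      using measurable_sets[OF R A] sets.sets_into_space[OF A]
      by (simp add: space_P space_R Int_absorb2)
  qed
qed

text \<open>
  The Radon-Nikodym density of \<open>N\<close> exceeds 1 at most on a null set, for otherwise that set would have
  larger mass under \<open>N\<close> than under \<open>M\<close>. Truncating it at 1 makes it real-valued with the bounds holding everywhere.
\<close>
lemma (in finite_measure) dominated_measure_density: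
  assumes sets: "sets N = sets M" and le: "\<And>A. A \<in> sets M \<Longrightarrow> emeasure N A \<le> emeasure M A"
  obtains f where "f \<in> borel_measurable M" "\<And>x. f x \<in> {0..1}" "N = density M (\<lambda>x. ennreal (f x))"
proof -
  have "absolutely_continuous M N"
    using le by (auto simp: absolutely_continuous_def null_sets_def sets)
      (metis le_zero_eq)
  then obtain \<phi> where \<phi>: "\<phi> \<in> borel_measurable M" "density M \<phi> = N"
    using Radon_Nikodym sets by blast
  define A where "A = {x \<in> space M. 1 < \<phi> x}"
  have A: "A \<in> sets M" using \<phi>(1) unfolding A_def by measurable
  have "AE x in M. \<phi> x * indicator A x \<le> indicator A x"
  proof (rule ccontr)
    assume "\<not> ?thesis"
    then have "(\<integral>\<^sup>+x. indicator A x \<partial>M) < (\<integral>\<^sup>+x. \<phi> x * indicator A x \<partial>M)"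
    proof (intro nn_integral_less)
      show "(\<integral>\<^sup>+x. indicator A x \<partial>M) \<noteq> \<infinity>"
        using A by (simp add: emeasure_eq_measure)
      show "AE x in M. indicator A x \<le> \<phi> x * indicator A x"
        by (auto simp: A_def indicator_def)
    qed (use \<phi>(1) A in auto)
    then have "emeasure M A < emeasure N A"
      using A \<phi> by (simp add: emeasure_density[symmetric])
    with le[OF A] show False by simp
  qed
  then have AE: "AE x in M. \<phi> x \<le> 1"
  proof (rule AE_mp, intro AE_I2 impI)
    fix x assume "x \<in> space M" "\<phi> x * indicator A x \<le> indicator A x"
    then show "\<phi> x \<le> 1" by (cases "x \<in> A") (auto simp: A_def not_less)
  qed
  define f where "f x = enn2real (min 1 (\<phi> x))" for x
  show ?thesis
  proof (rule that[of f])
    show "f \<in> borel_measurable M" unfolding f_def using \<phi>(1) by measurable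
    show "f x \<in> {0..1}" for x
      using enn2real_mono[of "min 1 (\<phi> x)" 1] by (simp add: f_def)
    have "AE x in M. \<phi> x = ennreal (f x)"
      using AE
    proof eventually_elim
      case (elim x)
      then have "\<phi> x < top" using ennreal_one_less_top le_less_trans by blast
      with elim show ?case by (simp add: f_def min_absorb2)
    qed
    then show "N = density M (\<lambda>x. ennreal (f x))"
      using \<phi> \<open>f \<in> borel_measurable M\<close> by (subst \<phi>(2)[symmetric], intro density_cong) auto
  qed
qed

section \<open>Transport plans to a finite target as densities\<close>

locale finite_target =
  fixes \<mu> :: "'a::second_countable_topology measure" and X :: "'a set"
    and y :: "'N::finite \<Rightarrow> 'b::{second_countable_topology, t1_space}"
  assumes \<mu>: "\<mu> \<in> borel_prob_measures X" and inj: "inj y"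
begin

definition reference :: "('a \<times> 'b) measure" where
  "reference = \<mu> \<Otimes>\<^sub>M count_space (range y)"

sublocale \<mu>: prob_space \<mu>
  by (rule borel_prob_measuresD(1)[OF \<mu>])

sublocale target: finite_measure "count_space (range y)"
  by (rule finite_measure_count_space) simp

lemma space_\<mu>: "space \<mu> = X"
  by (rule borel_prob_measuresD(3)[OF \<mu>])

lemma space_reference: "space reference = X \<times> range y"
  by (simp add: reference_def space_pair_measure space_\<mu>)

lemma sets_reference: "sets reference = sets (restrict_space borel (X \<times> range y))"
proof -
  have "sets reference = sets (restrict_space borel X \<Otimes>\<^sub>M restrict_space borel (range y))"
    unfolding reference_def
    by (intro sets_pair_measure_cong)
      (simp_all add: borel_prob_measuresD(2)[OF \<mu>] sets_restrict_borel_finite)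
  then show ?thesis
    by (simp add: sets_restrict_borel_Times)
qed

lemma strip_in_sets_reference: "A \<in> sets \<mu> \<Longrightarrow> B \<subseteq> range y \<Longrightarrow> A \<times> B \<in> sets reference"
  by (auto simp: reference_def)

lemma emeasure_reference_Times:
  assumes "A \<in> sets \<mu>" "B \<subseteq> range y"
  shows "emeasure reference (A \<times> B) = emeasure \<mu> A * card B"
proof -
  have "finite B" using assms(2) by (rule finite_subset) simp
  then show ?thesis
    using assms unfolding reference_def
    by (subst target.emeasure_pair_measure_Times) (auto simp: ennreal_of_nat_eq_real_of_nat)
qed

lemma slice_in_sets: "A \<in> sets reference \<Longrightarrow> (\<lambda>x. (x, y j)) -` A \<in> sets \<mu>"
  unfolding reference_def by (rule sets_Pair2)

lemma emeasure_reference: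
  assumes "A \<in> sets reference"
  shows "emeasure reference A = (\<Sum>j\<in>UNIV. emeasure \<mu> ((\<lambda>x. (x, y j)) -` A))"
proof -
  interpret pair_sigma_finite \<mu> "count_space (range y)" ..
  have "emeasure reference A = (\<Sum>b\<in>range y. emeasure \<mu> ((\<lambda>x. (x, b)) -` A))"
    using assms unfolding reference_def
    by (subst emeasure_pair_measure_alt2) (auto simp: nn_integral_count_space_finite)
  then show ?thesis
    using inj by (simp add: sum.reindex)
qed

sublocale reference: finite_measure reference
  by (rule finite_measureI)
    (simp add: space_reference emeasure_reference_Times space_\<mu>[symmetric] \<mu>.emeasure_space_1 ennreal_of_nat_eq_real_of_nat)

text \<open>
  \<open>A\<close> is covered by the strips \<open>A\<^sub>j \<times> Y\<close>, where \<open>A\<^sub>j\<close> is the slice of \<open>A\<close> over \<open>y j\<close>. The left marginal condition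
  gives the strip mass \<open>\<mu> A\<^sub>j\<close>, and these masses add up to the reference mass of \<open>A\<close>.
\<close>
lemma transport_plan_le_reference:
  assumes G: "G \<in> transport_plans \<mu> (discrete_measure y l)" and A: "A \<in> sets reference"
  shows "emeasure G A \<le> emeasure reference A"
proof -
  have sets_G: "sets G = sets reference" and space_G: "space G = X \<times> range y"
    and fst: "distr G \<mu> fst = \<mu>"
    using G borel_prob_measuresD[of G "X \<times> range y"]
    by (auto simp: transport_plans_def space_\<mu> sets_reference)
  let ?S = "\<lambda>j. (\<lambda>x. (x, y j)) -` A"
  have fst_meas: "fst \<in> G \<rightarrow>\<^sub>M \<mu>"
  proof -
    have "fst \<in> reference \<rightarrow>\<^sub>M \<mu>" by (simp add: reference_def)
    then show ?thesis using measurable_cong_sets[OF sets_G refl] by blast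
  qed
  have strip: "emeasure G (?S j \<times> range y) = emeasure \<mu> (?S j)" for j
  proof -
    have "?S j \<times> range y = fst -` ?S j \<inter> space G"
      using sets.sets_into_space[OF slice_in_sets[OF A]] by (auto simp: space_G space_\<mu>)
    then show ?thesis
      using emeasure_distr[OF fst_meas slice_in_sets[OF A, of j]] by (simp add: fst)
  qed
  have "A \<subseteq> (\<Union>j. ?S j \<times> range y)"
  proof
    fix p assume "p \<in> A"
    moreover from this obtain a j where "p = (a, y j)"
      using sets.sets_into_space[OF A] by (auto simp: space_reference)
    ultimately show "p \<in> (\<Union>j. ?S j \<times> range y)" by auto
  qed
  then have "emeasure G A \<le> emeasure G (\<Union>j. ?S j \<times> range y)"
    by (intro emeasure_mono) (auto simp: sets_G intro!: strip_in_sets_reference slice_in_sets[OF A])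
  also have "\<dots> \<le> (\<Sum>j\<in>UNIV. emeasure G (?S j \<times> range y))"
    by (intro emeasure_subadditive_finite)
      (auto simp: sets_G intro!: strip_in_sets_reference slice_in_sets[OF A])
  finally show ?thesis
    by (simp add: strip emeasure_reference[OF A])
qed

lemma transport_plan_density:
  assumes "G \<in> transport_plans \<mu> (discrete_measure y l)"
  obtains f where "f \<in> borel_measurable reference" "\<And>p. f p \<in> {0..1}" "G = density reference (\<lambda>p. ennreal (f p))"
proof -
  have "sets G = sets reference"
    using assms by (auto simp: transport_plans_def space_\<mu> sets_reference dest: borel_prob_measuresD)
  then show ?thesis
    using reference.dominated_measure_density transport_plan_le_reference[OF assms] that by metis
qed

lemma emeasure_unit_density:
  assumes f: "f \<in> borel_measurable reference" "\<And>p. f p \<in> {0..1}" and A: "A \<in> sets reference"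
  shows "emeasure (density reference (\<lambda>p. ennreal (f p))) A = ennreal (\<integral>p. indicator A p * f p \<partial>reference)"
proof -
  have int: "integrable reference (\<lambda>p. indicator A p * f p)"
    by (rule integrable_mult_unit_interval[OF _ f]) (use A in \<open>simp add: reference.emeasure_eq_measure\<close>)
  have "emeasure (density reference (\<lambda>p. ennreal (f p))) A = (\<integral>\<^sup>+p. ennreal (indicator A p * f p) \<partial>reference)"
    using f(1) A by (subst emeasure_density) (auto intro!: nn_integral_cong simp: indicator_def)
  also have "\<dots> = ennreal (\<integral>p. indicator A p * f p \<partial>reference)"
    using f(2) by (intro nn_integral_eq_integral int) (auto simp: indicator_def)
  finally show ?thesis .
qed

text \<open>
  Being a plan is a system of linear equations for the density. It is this form that is stable under weak
  limits. The second marginal is a measure on a finite set, so only its singletons need checking.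
\<close>
lemma density_transport_plan_iff:
  assumes f: "f \<in> borel_measurable reference" "\<And>p. f p \<in> {0..1}" and l: "\<And>j. 0 \<le> l $ j"
  shows "density reference (\<lambda>p. ennreal (f p)) \<in> transport_plans \<mu> (discrete_measure y l) \<longleftrightarrow>
    (\<forall>A\<in>sets \<mu>. (\<integral>p. indicator (A \<times> range y) p * f p \<partial>reference) = measure \<mu> A) \<and>
    (\<forall>j. (\<integral>p. indicator (X \<times> {y j}) p * f p \<partial>reference) = l $ j)"
proof -
  let ?G = "density reference (\<lambda>p. ennreal (f p))"
  let ?I = "\<lambda>A. \<integral>p. indicator A p * f p \<partial>reference"
  have I_nonneg: "0 \<le> ?I A" for A
    using f(2) by (intro integral_nonneg_AE) (auto simp: indicator_def)
  have X: "X \<in> sets \<mu>" using sets.top[of \<mu>] by (simp add: space_\<mu>)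
  have fst_meas: "fst \<in> ?G \<rightarrow>\<^sub>M \<mu>"
    by (simp add: reference_def)
  have snd_meas: "snd \<in> ?G \<rightarrow>\<^sub>M discrete_measure y l"
  proof -
    have "snd \<in> reference \<rightarrow>\<^sub>M count_space (range y)" by (simp add: reference_def)
    moreover have "sets (discrete_measure y l) = sets (count_space (range y))"
      by (simp add: sets_restrict_borel_finite)
    ultimately show ?thesis
      using measurable_cong_sets[OF refl, of "discrete_measure y l" "count_space (range y)" reference] by simp
  qed
  have fst: "emeasure (distr ?G \<mu> fst) A = ennreal (?I (A \<times> range y))" if "A \<in> sets \<mu>" for A
  proof -
    have "fst -` A \<inter> space ?G = A \<times> range y"
      using sets.sets_into_space[OF that] by (auto simp: space_reference space_\<mu>)
    then show ?thesis
      using that by (simp add: emeasure_distr[OF fst_meas] emeasure_unit_density[OF f] strip_in_sets_reference)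
  qed
  have snd: "emeasure (distr ?G (discrete_measure y l) snd) {y j} = ennreal (?I (X \<times> {y j}))" for j
  proof -
    have "snd -` {y j} \<inter> space ?G = X \<times> {y j}"
      by (auto simp: space_reference)
    then show ?thesis
      using X by (subst emeasure_distr[OF snd_meas])
        (simp_all add: emeasure_unit_density[OF f] strip_in_sets_reference sets_restrict_borel_finite)
  qed
  have discrete: "emeasure (discrete_measure y l) {y j} = ennreal (l $ j)" for j
  proof -
    have "emeasure (discrete_measure y l) {y j} = (\<Sum>i\<in>UNIV. ennreal (l $ i) * indicator {y j} (y i))"
      by (rule emeasure_discrete_measure) (simp add: sets_restrict_borel_finite)
    also have "\<dots> = (\<Sum>i\<in>{j}. ennreal (l $ i))"
      using inj by (intro sum.mono_neutral_cong_right) (auto simp: inj_eq)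
    finally show ?thesis by simp
  qed
  have "distr ?G \<mu> fst = \<mu> \<longleftrightarrow> (\<forall>A\<in>sets \<mu>. ?I (A \<times> range y) = measure \<mu> A)"
  proof
    assume eq: "distr ?G \<mu> fst = \<mu>"
    show "\<forall>A\<in>sets \<mu>. ?I (A \<times> range y) = measure \<mu> A"
      using fst I_nonneg by (auto simp: eq \<mu>.emeasure_eq_measure)
  next
    assume "\<forall>A\<in>sets \<mu>. ?I (A \<times> range y) = measure \<mu> A"
    then show "distr ?G \<mu> fst = \<mu>"
      by (intro measure_eqI) (auto simp: fst \<mu>.emeasure_eq_measure)
  qed
  moreover have "distr ?G (discrete_measure y l) snd = discrete_measure y l \<longleftrightarrow>
      (\<forall>j. ?I (X \<times> {y j}) = l $ j)"
  proof
    assume eq: "distr ?G (discrete_measure y l) snd = discrete_measure y l"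
    show "\<forall>j. ?I (X \<times> {y j}) = l $ j"
    proof
      fix j
      have "ennreal (?I (X \<times> {y j})) = ennreal (l $ j)"
        using snd[of j] by (simp only: eq discrete)
      then show "?I (X \<times> {y j}) = l $ j"
        using I_nonneg l by simp
    qed
  next
    assume "\<forall>j. ?I (X \<times> {y j}) = l $ j"
    then show "distr ?G (discrete_measure y l) snd = discrete_measure y l"
      by (intro measure_eqI_finite[of _ "range y"])
        (auto simp: sets_restrict_borel_finite snd discrete)
  qed
  moreover have "?G \<in> borel_prob_measures (X \<times> range y)" if "distr ?G \<mu> fst = \<mu>"
  proof -
    have "prob_space (distr ?G \<mu> fst)"
      using \<mu>.prob_space_axioms that by simp
    then have "prob_space ?G"
      by (rule prob_space_distrD[OF fst_meas])
    then show ?thesis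
      by (simp add: borel_prob_measures_def sets_reference)
  qed
  ultimately show ?thesis
    by (auto simp: transport_plans_def space_\<mu>)
qed

text \<open>
  The product of \<open>\<mu>\<close> with the uniform distribution on \<open>Y\<close>; it shows that there is something to minimise over.
\<close>
lemma uniform_transport_plan:
  shows "(\<chi> j. 1 / CARD('N)) \<in> (weight_simplex :: (real ^ 'N) set)"
    and "density reference (\<lambda>p. ennreal (1 / CARD('N))) \<in>
      transport_plans \<mu> (discrete_measure y (\<chi> j. 1 / CARD('N)))"
proof -
  show "(\<chi> j. 1 / CARD('N)) \<in> (weight_simplex :: (real ^ 'N) set)"
    by (simp add: weight_simplex_def)
  have "measure reference (A \<times> B) = measure \<mu> A * card B" if "A \<in> sets \<mu>" "B \<subseteq> range y" for A B
    using emeasure_reference_Times[OF that]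
    by (simp add: measure_def enn2real_mult ennreal_of_nat_eq_real_of_nat)
  then show "density reference (\<lambda>p. ennreal (1 / CARD('N))) \<in>
      transport_plans \<mu> (discrete_measure y (\<chi> j. 1 / CARD('N)))"
    using sets.top[of \<mu>] inj \<mu>.prob_space
    by (subst density_transport_plan_iff)
      (auto simp: strip_in_sets_reference space_\<mu> card_image sets.Int_space_eq2)
qed

end

section \<open>Existence of a minimiser\<close>

lemma compact_weight_simplex: "compact (weight_simplex :: (real ^ 'N::finite) set)"
proof -
  have eq: "(weight_simplex :: (real ^ 'N) set) = {l. (\<Sum>j\<in>UNIV. l $ j) = 1} \<inter> (\<Inter>j. {l. 0 \<le> l $ j})"
    by (auto simp: weight_simplex_def)
  have "closed (weight_simplex :: (real ^ 'N) set)"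
    unfolding eq by (intro closed_Int closed_INT ballI closed_Collect_eq closed_Collect_le continuous_intros)
  moreover have "bounded (weight_simplex :: (real ^ 'N) set)"
  proof (rule bounded_subset[OF bounded_cbox])
    show "(weight_simplex :: (real ^ 'N) set) \<subseteq> cbox 0 1"
    proof
      fix l :: "real ^ 'N" assume l: "l \<in> weight_simplex"
      have "l $ j \<le> (\<Sum>i\<in>UNIV. l $ i)" for j
        by (rule member_le_sum) (use l in \<open>auto simp: weight_simplex_def\<close>)
      then show "l \<in> cbox 0 1"
        using l by (auto simp: weight_simplex_def mem_box_cart)
    qed
  qed
  ultimately show ?thesis
    by (simp add: compact_eq_bounded_closed)
qed

text \<open>
  Taking the infimum in the extended reals allows \<open>J\<close> to be unbounded below, so that a lower bound
  need not be established beforehand; it is a consequence of the existence of a minimiser.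
\<close>
lemma ex_minimising_sequence:
  fixes J :: "'s \<Rightarrow> real"
  assumes "S \<noteq> {}"
  obtains s where "\<And>k::nat. s k \<in> S" "\<And>t e. t \<in> S \<Longrightarrow> 0 < e \<Longrightarrow> \<forall>\<^sub>F k in sequentially. J (s k) < J t + e"
proof -
  obtain u where u: "\<And>k. u k \<in> (\<lambda>t. ereal (J t)) ` S" "u \<longlonglongrightarrow> Inf ((\<lambda>t. ereal (J t)) ` S)"
    using Inf_as_limit[of "(\<lambda>t. ereal (J t)) ` S"] assms by auto
  then have "\<forall>k. \<exists>t\<in>S. u k = ereal (J t)" by blast
  then obtain s where s: "\<And>k. s k \<in> S" "\<And>k. u k = ereal (J (s k))" by metis
  show ?thesis
  proof (rule that[OF s(1)])
    fix t and e :: real assume "t \<in> S" "0 < e"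
    then have "Inf ((\<lambda>t. ereal (J t)) ` S) \<le> ereal (J t)" "ereal (J t) < ereal (J t + e)"
      by (auto intro: INF_lower)
    then have "Inf ((\<lambda>t. ereal (J t)) ` S) < ereal (J t + e)"
      by (rule le_less_trans)
    from order_tendstoD(2)[OF u(2) this] show "\<forall>\<^sub>F k in sequentially. J (s k) < J t + e"
      by (simp add: s(2))
  qed
qed

theorem theorem2p3:
  fixes y :: "'N::finite \<Rightarrow> real ^ 'n::finite"
    and Y X :: "(real ^ 'n) set"
    and \<mu> :: "(real ^ 'n) measure"
    and c :: "(real ^ 'n) \<times> (real ^ 'n) \<Rightarrow> real"
    and F :: "real ^ 'N \<Rightarrow> real"
  assumes "inj y" and "Y = range y"
    and "compact X"
    and "\<mu> \<in> borel_prob_measures X" and "spt \<mu> = X"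
    and "continuous_on (X \<times> Y) c" and "bounded (c ` (X \<times> Y))"
    and "\<forall>p \<in> X \<times> Y. 0 \<le> c p"
    and "lower_semicontinuous F"
  shows "\<exists>l \<in> weight_simplex. \<exists>\<gamma> \<in> transport_plans \<mu> (discrete_measure y l).
           \<forall>l' \<in> weight_simplex. \<forall>\<gamma>' \<in> transport_plans \<mu> (discrete_measure y l').
             integral\<^sup>L \<gamma> c + F l \<le> integral\<^sup>L \<gamma>' c + F l'"
proof -
  interpret finite_target \<mu> X y
    using assms(1,4) by unfold_locales
  let ?plans = "\<lambda>l. transport_plans \<mu> (discrete_measure y l)"
  define S where "S = (SIGMA l:weight_simplex. ?plans l)"
  define J where "J s = integral\<^sup>L (snd s) c + F (fst s)" for s
  have "S \<noteq> {}"
    using uniform_transport_plan by (auto simp: S_def)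
  then obtain s where s: "\<And>k::nat. s k \<in> S"
      and s_min: "\<And>t e. t \<in> S \<Longrightarrow> 0 < e \<Longrightarrow> \<forall>\<^sub>F k in sequentially. J (s k) < J t + e"
    using ex_minimising_sequence[of S J] by blast
  define l where "l k = fst (s k)" for k
  define G where "G k = snd (s k)" for k
  have l: "l k \<in> weight_simplex" and G: "G k \<in> ?plans (l k)" for k
    using s[of k] by (auto simp: S_def l_def G_def)
  have "\<exists>f. f \<in> borel_measurable reference \<and> (\<forall>p. f p \<in> {0..1}) \<and> G k = density reference (\<lambda>p. ennreal (f p))" for k
    using transport_plan_density[OF G] by metis
  then obtain f where f: "\<And>k. f k \<in> borel_measurable reference" "\<And>k p. f k p \<in> {0..1}"
      and G_f: "\<And>k. G k = density reference (\<lambda>p. ennreal (f k p))"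
    by metis
  have c_meas: "c \<in> borel_measurable reference"
  proof -
    have "c \<in> borel_measurable (restrict_space borel (X \<times> range y))"
      using assms(2,6) by (intro borel_measurable_continuous_on_restrict) simp
    then show ?thesis
      using measurable_cong_sets[OF sets_reference refl] by blast
  qed
  obtain B where B: "\<And>p. p \<in> X \<times> range y \<Longrightarrow> norm (c p) \<le> B"
    using assms(2,7) by (auto simp: bounded_iff)
  have c_int: "integrable reference c"
    by (rule reference.integrable_const_bound[OF AE_I2 c_meas]) (use B in \<open>simp add: space_reference\<close>)
  have cost: "integral\<^sup>L (density reference (\<lambda>p. ennreal (g p))) c = (\<integral>p. c p * g p \<partial>reference)"
    if "g \<in> borel_measurable reference" "\<And>p. g p \<in> {0..1}" for g
    using that c_meas by (subst integral_density) (auto simp: mult.commute)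
  have "norm (\<integral>p. c p * f k p \<partial>reference) \<le> (\<integral>p. norm (c p) \<partial>reference)" for k
  proof (rule Bochner_Integration.integral_norm_bound_integral)
    show "norm (c p * f k p) \<le> norm (c p)" for p
      using f(2)[of k p] by (simp add: abs_mult mult_left_le)
  qed (use integrable_mult_unit_interval[OF c_int f] c_int in auto)
  then have "\<forall>k. (l k, \<integral>p. c p * f k p \<partial>reference) \<in> weight_simplex \<times> cball (0::real) (\<integral>p. norm (c p) \<partial>reference)"
    using l by simp
  moreover have "seq_compact ((weight_simplex :: (real ^ 'N) set) \<times> cball (0::real) (\<integral>p. norm (c p) \<partial>reference))"
    by (intro compact_imp_seq_compact compact_Times compact_weight_simplex compact_cball)
  ultimately obtain q r where q: "q \<in> weight_simplex \<times> cball (0::real) (\<integral>p. norm (c p) \<partial>reference)"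
    and r: "strict_mono (r :: nat \<Rightarrow> nat)"
    and q_lim: "((\<lambda>k. (l k, \<integral>p. c p * f k p \<partial>reference)) \<circ> r) \<longlonglongrightarrow> q"
    by (elim seq_compactE[rotated]) auto
  define l' where "l' = fst q"
  define C where "C = snd q"
  have l'_simplex: "l' \<in> weight_simplex" using q by (auto simp: l'_def)
  have l_lim: "(\<lambda>k. l (r k)) \<longlonglongrightarrow> l'" and C_lim: "(\<lambda>k. \<integral>p. c p * f (r k) p \<partial>reference) \<longlonglongrightarrow> C"
    using tendsto_fst[OF q_lim] tendsto_snd[OF q_lim] by (auto simp: l'_def C_def o_def)
  \<comment> \<open>The weak limit is taken only along the subsequence, where weights and costs already converge.\<close>
  obtain g where g: "g \<in> borel_measurable reference" "\<And>p. g p \<in> {0..1}"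
    and g_lim: "\<And>h L. integrable reference h \<Longrightarrow> (\<lambda>k. \<integral>p. h p * f (r k) p \<partial>reference) \<longlonglongrightarrow> L \<Longrightarrow> (\<integral>p. h p * g p \<partial>reference) = L"
    by (rule reference.unit_interval_functions_weakly_compact[of "\<lambda>k. f (r k)"]) (use f in auto)
  let ?G' = "density reference (\<lambda>p. ennreal (g p))"
  have nonneg: "0 \<le> m $ j" if "m \<in> weight_simplex" for m :: "real ^ 'N" and j
    using that by (simp add: weight_simplex_def)
  have marginals: "(\<integral>p. indicator (A \<times> range y) p * f k p \<partial>reference) = measure \<mu> A"
      "(\<integral>p. indicator (X \<times> {y j}) p * f k p \<partial>reference) = l k $ j" if "A \<in> sets \<mu>" for k A j
    using G[of k] density_transport_plan_iff[OF f nonneg[OF l], of k k] that by (auto simp: G_f)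
  have X: "X \<in> sets \<mu>" using sets.top[of \<mu>] by (simp add: space_\<mu>)
  have ind: "integrable reference (indicator (A \<times> B) :: _ \<Rightarrow> real)" if "A \<in> sets \<mu>" "B \<subseteq> range y" for A B
    using strip_in_sets_reference[OF that] by (simp add: reference.emeasure_eq_measure)
  have G'_plan: "?G' \<in> ?plans l'"
  proof (subst density_transport_plan_iff[OF g nonneg[OF l'_simplex]], intro conjI ballI allI)
    show "(\<integral>p. indicator (A \<times> range y) p * g p \<partial>reference) = measure \<mu> A" if "A \<in> sets \<mu>" for A
      using ind[OF that] marginals(1)[OF that] by (intro g_lim) auto
    show "(\<integral>p. indicator (X \<times> {y j}) p * g p \<partial>reference) = l' $ j" for j
      using ind[OF X] marginals(2)[OF X] by (intro g_lim) (auto intro!: tendsto_vec_nth[OF l_lim])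
  qed
  have G'_cost: "integral\<^sup>L ?G' c = C"
    using cost[OF g] g_lim[OF c_int C_lim] by simp
  \<comment> \<open>Half of \<open>e\<close> pays for lower semicontinuity of \<open>F\<close> at \<open>l'\<close>, half for near-minimality of the sequence.\<close>
  have "C + F l' \<le> J t" if t: "t \<in> S" for t
  proof (rule field_le_epsilon)
    fix e :: real assume "0 < e"
    have "F l' - e / 2 < F l'" using \<open>0 < e\<close> by simp
    then have "\<forall>\<^sub>F z in nhds l'. F l' - e / 2 < F z"
      using assms(9) by (simp add: lower_semicontinuous_def)
    then have 1: "\<forall>\<^sub>F k in sequentially. F l' - e / 2 < F (l (r k))"
      by (rule eventually_compose_filterlim[OF _ l_lim])
    have "0 < e / 2" using \<open>0 < e\<close> by simp
    then have 2: "\<forall>\<^sub>F k in sequentially. J (s (r k)) < J t + e / 2"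
      by (intro eventually_subseq[OF r] s_min[OF t])
    have "\<forall>\<^sub>F k in sequentially. (\<integral>p. c p * f (r k) p \<partial>reference) \<le> J t + e - F l'"
      using 1 2
    proof eventually_elim
      case (elim k)
      have "J (s (r k)) = (\<integral>p. c p * f (r k) p \<partial>reference) + F (l (r k))"
        unfolding J_def l_def[symmetric] G_def[symmetric] G_f using cost[OF f] by simp
      with elim show ?case by simp
    qed
    then have "C \<le> J t + e - F l'"
      by (intro tendsto_upperbound[OF C_lim]) auto
    then show "C + F l' \<le> J t + e" by simp
  qed
  then have "\<forall>m\<in>weight_simplex. \<forall>\<gamma>\<in>?plans m. integral\<^sup>L ?G' c + F l' \<le> integral\<^sup>L \<gamma> c + F m"
    by (force simp: S_def J_def G'_cost)
  with l'_simplex G'_plan show ?thesis by blast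
qed

end
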